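(* Let $\mathcal{R}$ be a (constructor, orthogonal) term rewriting system having an additive interpretation $[-]$ over $\mathbb{K}$, where $\mathbb{K}\in\{\mathbb{N},\mathbb{Q}^+,\mathbb{R}^+\}$. Then $[-]$ is a sup-interpretation of $\mathcal{R}$.
   Context: A constructor TRS consists of disjoint sets $\mathcal{C}$ (constructors) and $\mathcal{D}$ (defined function symbols) of symbols with fixed arities, variables, and a finite set $\mathcal{R}$ of rules $l\to r$ with $l=\mathtt{f}(t_1,\dots,t_n)$, $\mathtt{f}\in\mathcal{D}$, each $t_i$ built from constructors and variables, and every variable of $r$ occurring in $l$; throughout, TRS are orthogonal (left-linear, no overlaps). $\to_\mathcal{R}$ is the usual one-step rewrite relation (apply a rule instance in any context). Values are closed constructor terms. For $\mathtt{f}\in\mathcal{D}$ of arity $n$ and values $v_1,\dots,v_n$, $[\![\mathtt{f}]\!](v_1,\dots,v_n)=v$ iff $\mathtt{f}(v_1,\dots,v_n)\to_\mathcal{R}^* v$ with $v$ a value; $\mathtt{f}(v_1,\dots,v_n)\downarrow$ means such a $v$ exists. $\mathbb{Q}^+,\mathbb{R}^+$ denote the nonnegative rationals/reals with their usual order. An assignment $\theta$ over $\mathbb{K}$ maps each symbol $\mathtt{g}\in\mathcal{C}\cup\mathcal{D}$ of arity $m$ to a total function $\theta(\mathtt{g}):\mathbb{K}^m\to\mathbb{K}$ and variables to variables ranging over $\mathbb{K}$; it is extended to terms by $\theta(\mathtt{g}(e_1,\dots,e_n))=\theta(\mathtt{g})(\theta(e_1),\dots,\theta(e_n))$. It is additive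 if every constructor $c$ of arity $n>0$ gets $\theta(c)=\lambda x_1\dots x_n.\,x_1+\dots+x_n+k_c$ with $k_c\geq 1$ and every constructor of arity $0$ gets $0$. It is monotonic if each $\theta(\mathtt{g})$ is nondecreasing in each argument, and strictly monotonic if for each argument position $i$, all argument values and every $\delta>0$ there is $\epsilon>0$ such that increasing the $i$-th argument by $\delta$ increases the value by at least $\epsilon$. An interpretation is a strictly monotonic assignment $[-]$ such that (1) $[l]>[r]$ for every rule $l\to r$ (for all values in $\mathbb{K}$ of the variables), and (2) if $\mathbb{K}\in\{\mathbb{Q}^+,\mathbb{R}^+\}$, either (a) every symbol $\mathtt{g}$ of arity $m>0$ satisfies $[\mathtt{g}](X_1,\dots,X_m)>X_i$ for all $i$, or (b) there is $\delta>0$ with $[l]\geq\delta+[r]$ for every rule. A sup-interpretation over $\mathbb{K}$ is a monotonic additive assignment $\theta$ such that for every $\mathtt{f}\in\mathcal{D}$ of arity $m$ and all values $v_1,\dots,v_m$: $\mathtt{f}(v_1,\dots,v_m)\downarrow\implies \theta(\mathtt{f}(v_1,\dots,v_m))\geq\theta([\![\mathtt{f}]\!](v_1,\dots,v_m))$. *)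

theory Defs imports Complex_Main begin

section \<open>First-order terms and constructor rewrite systems\<close>

datatype ('f, vars: 'v) trm = Var 'v | Fun 'f "('f, 'v) trm list"

primrec subst :: "('v \<Rightarrow> ('f, 'w) trm) \<Rightarrow> ('f, 'v) trm \<Rightarrow> ('f, 'w) trm" where
  "subst \<sigma> (Var x) = \<sigma> x"
| "subst \<sigma> (Fun f ts) = Fun f (map (subst \<sigma>) ts)"

primrec var_occs :: "('f, 'v) trm \<Rightarrow> 'v list" where
  "var_occs (Var x) = [x]"
| "var_occs (Fun f ts) = concat (map var_occs ts)"

fun subterms :: "('f, 'v) trm \<Rightarrow> ('f, 'v) trm set" where
  "subterms (Var x) = {Var x}"
| "subterms (Fun f ts) = insert (Fun f ts) (\<Union>t\<in>set ts. subterms t)"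

fun term_over :: "('f \<Rightarrow> nat) \<Rightarrow> 'f set \<Rightarrow> ('f, 'v) trm \<Rightarrow> bool" where
  "term_over ar F (Var x) \<longleftrightarrow> True"
| "term_over ar F (Fun f ts) \<longleftrightarrow> f \<in> F \<and> length ts = ar f \<and> (\<forall>t\<in>set ts. term_over ar F t)"

record ('f, 'v) trs =
  constructors :: "'f set"
  defined :: "'f set"
  arity :: "'f \<Rightarrow> nat"
  rules :: "(('f, 'v) trm \<times> ('f, 'v) trm) set"

definition symbols :: "('f, 'v) trs \<Rightarrow> 'f set" where
  "symbols T = constructors T \<union> defined T"

definition constructor_trs :: "('f, 'v) trs \<Rightarrow> bool" where
  "constructor_trs T \<longleftrightarrow>
     constructors T \<inter> defined T = {} \<and>
     finite (rules T) \<and>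
     (\<forall>(l, r)\<in>rules T.
        (\<exists>f ts. l = Fun f ts \<and> f \<in> defined T \<and> length ts = arity T f \<and>
                (\<forall>t\<in>set ts. term_over (arity T) (constructors T) t)) \<and>
        term_over (arity T) (symbols T) r \<and>
        vars r \<subseteq> vars l)"

definition left_linear :: "('f, 'v) trs \<Rightarrow> bool" where
  "left_linear T \<longleftrightarrow> (\<forall>(l, r)\<in>rules T. distinct (var_occs l))"

definition rule_variant ::
  "('f, 'v) trm \<times> ('f, 'v) trm \<Rightarrow> ('f, 'v) trm \<times> ('f, 'v) trm \<Rightarrow> bool" where
  "rule_variant p q \<longleftrightarrow>
     (\<exists>\<pi>. bij \<pi> \<and> fst q = subst (Var \<circ> \<pi>) (fst p) \<and> snd q = subst (Var \<circ> \<pi>) (snd p))"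

text \<open>
  Instead of renaming the two rules apart, the left-hand sides are instantiated by two
  independent substitutions. A subterm of \<open>l\<close> equal to \<open>l\<close> sits at the root; only there is the
  trivial overlap of a rule with a renaming of itself exempted.
\<close>
definition non_overlapping :: "('f, 'v) trs \<Rightarrow> bool" where
  "non_overlapping T \<longleftrightarrow>
     (\<forall>(l, r)\<in>rules T. \<forall>(l', r')\<in>rules T. \<forall>u\<in>subterms l.
        (\<forall>x. u \<noteq> Var x) \<longrightarrow> \<not> (u = l \<and> rule_variant (l, r) (l', r')) \<longrightarrow>
        \<not> (\<exists>(\<sigma> :: 'v \<Rightarrow> ('f, 'v) trm) (\<tau> :: 'v \<Rightarrow> ('f, 'v) trm). subst \<sigma> u = subst \<tau> l'))"

definition orthogonal :: "('f, 'v) trs \<Rightarrow> bool" where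
  "orthogonal T \<longleftrightarrow> left_linear T \<and> non_overlapping T"

text \<open>
  The substitutions and contexts below are not restricted to the signature: since right-hand sides
  introduce no new variables, rewriting a term over the signature stays within the signature.
\<close>
inductive rstep :: "('f, 'v) trs \<Rightarrow> ('f, 'v) trm \<Rightarrow> ('f, 'v) trm \<Rightarrow> bool" for T where
  root: "(l, r) \<in> rules T \<Longrightarrow> rstep T (subst \<sigma> l) (subst \<sigma> r)"
| arg: "rstep T s t \<Longrightarrow> rstep T (Fun f (ss @ s # us)) (Fun f (ss @ t # us))"

definition is_value :: "('f, 'v) trs \<Rightarrow> ('f, 'v) trm \<Rightarrow> bool" where
  "is_value T v \<longleftrightarrow> term_over (arity T) (constructors T) v \<and> vars v = {}"

text \<open>
  The graph of the partial function computed by \<open>f\<close>. Definedness of \<open>f\<close> on \<open>vs\<close> is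
  \<open>\<exists>v. computes T f vs v\<close>.
\<close>
definition computes ::
  "('f, 'v) trs \<Rightarrow> 'f \<Rightarrow> ('f, 'v) trm list \<Rightarrow> ('f, 'v) trm \<Rightarrow> bool" where
  "computes T f vs v \<longleftrightarrow> (rstep T)\<^sup>*\<^sup>* (Fun f vs) v \<and> is_value T v"

section \<open>Assignments\<close>

abbreviation nonneg_rats :: "real set" where
  "nonneg_rats \<equiv> {x \<in> \<rat>. 0 \<le> x}"

abbreviation nonneg_reals :: "real set" where
  "nonneg_reals \<equiv> {x. 0 \<le> x}"

definition tuples :: "real set \<Rightarrow> nat \<Rightarrow> real list set" where
  "tuples K m = {xs. length xs = m \<and> set xs \<subseteq> K}"

text \<open>
  A function from \<open>K\<^sup>m\<close> to \<open>K\<close> is represented by a function on lists whose values matter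
  only on \<open>tuples K m\<close>; likewise only the symbols of the rewrite system matter.
\<close>
type_synonym 'f assignment = "'f \<Rightarrow> real list \<Rightarrow> real"

definition assignment :: "real set \<Rightarrow> ('f, 'v) trs \<Rightarrow> 'f assignment \<Rightarrow> bool" where
  "assignment K T \<theta> \<longleftrightarrow>
     (\<forall>g\<in>symbols T. \<forall>xs\<in>tuples K (arity T g). \<theta> g xs \<in> K)"

primrec eval :: "'f assignment \<Rightarrow> ('v \<Rightarrow> real) \<Rightarrow> ('f, 'v) trm \<Rightarrow> real" where
  "eval \<theta> \<alpha> (Var x) = \<alpha> x"
| "eval \<theta> \<alpha> (Fun g ts) = \<theta> g (map (eval \<theta> \<alpha>) ts)"

definition valuation :: "real set \<Rightarrow> ('v \<Rightarrow> real) \<Rightarrow> bool" where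
  "valuation K \<alpha> \<longleftrightarrow> (\<forall>x. \<alpha> x \<in> K)"

definition additive_assignment :: "real set \<Rightarrow> ('f, 'v) trs \<Rightarrow> 'f assignment \<Rightarrow> bool" where
  "additive_assignment K T \<theta> \<longleftrightarrow>
     (\<forall>c\<in>constructors T.
        (arity T c = 0 \<longrightarrow> \<theta> c [] = 0) \<and>
        (arity T c > 0 \<longrightarrow>
           (\<exists>k\<in>K. k \<ge> 1 \<and> (\<forall>xs\<in>tuples K (arity T c). \<theta> c xs = sum_list xs + k))))"

definition monotonic :: "real set \<Rightarrow> ('f, 'v) trs \<Rightarrow> 'f assignment \<Rightarrow> bool" where
  "monotonic K T \<theta> \<longleftrightarrow>
     (\<forall>g\<in>symbols T. \<forall>i<arity T g. \<forall>xs\<in>tuples K (arity T g). \<forall>y\<in>K.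
        xs ! i \<le> y \<longrightarrow> \<theta> g xs \<le> \<theta> g (xs[i := y]))"

definition strictly_monotonic :: "real set \<Rightarrow> ('f, 'v) trs \<Rightarrow> 'f assignment \<Rightarrow> bool" where
  "strictly_monotonic K T \<theta> \<longleftrightarrow>
     (\<forall>g\<in>symbols T. \<forall>i<arity T g. \<forall>xs\<in>tuples K (arity T g). \<forall>\<delta>\<in>K.
        \<delta> > 0 \<longrightarrow> (\<exists>\<epsilon>\<in>K. \<epsilon> > 0 \<and> \<theta> g (xs[i := xs ! i + \<delta>]) \<ge> \<theta> g xs + \<epsilon>))"

definition interpretation_over :: "real set \<Rightarrow> ('f, 'v) trs \<Rightarrow> 'f assignment \<Rightarrow> bool" where
  "interpretation_over K T \<theta> \<longleftrightarrow>
     assignment K T \<theta> \<and>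
     strictly_monotonic K T \<theta> \<and>
     (\<forall>(l, r)\<in>rules T. \<forall>\<alpha>. valuation K \<alpha> \<longrightarrow> eval \<theta> \<alpha> l > eval \<theta> \<alpha> r) \<and>
     (K \<in> {nonneg_rats, nonneg_reals} \<longrightarrow>
        (\<forall>g\<in>symbols T. \<forall>xs\<in>tuples K (arity T g). \<forall>i<arity T g. \<theta> g xs > xs ! i) \<or>
        (\<exists>\<delta>\<in>K. \<delta> > 0 \<and>
           (\<forall>(l, r)\<in>rules T. \<forall>\<alpha>. valuation K \<alpha> \<longrightarrow> eval \<theta> \<alpha> l \<ge> \<delta> + eval \<theta> \<alpha> r)))"

text \<open>
  The compared terms are closed, so the valuation \<open>\<alpha>\<close> has no influence on their values.
\<close>
definition sup_interpretation :: "real set \<Rightarrow> ('f, 'v) trs \<Rightarrow> 'f assignment \<Rightarrow> bool" where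
  "sup_interpretation K T \<theta> \<longleftrightarrow>
     assignment K T \<theta> \<and> monotonic K T \<theta> \<and> additive_assignment K T \<theta> \<and>
     (\<forall>f\<in>defined T. \<forall>vs. length vs = arity T f \<and> (\<forall>v\<in>set vs. is_value T v) \<longrightarrow>
        (\<forall>v. computes T f vs v \<longrightarrow>
           (\<forall>\<alpha>. valuation K \<alpha> \<longrightarrow> eval \<theta> \<alpha> (Fun f vs) \<ge> eval \<theta> \<alpha> v)))"

end

theory Submission imports Defs begin

text \<open>
  A rewrite step on a term over the signature stays over the signature and does not increase the
  value under the interpretation: at the root because \<open>[l] > [r]\<close>, and inside a context by
  monotonicity. Hence \<open>[f(v\<^sub>1, \<dots>, v\<^sub>n)] \<ge> [v]\<close> along every reduction
  \<open>f(v\<^sub>1, \<dots>, v\<^sub>n) \<rightarrow>\<^sup>* v\<close>.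
\<close>

lemma term_over_mono:
  "term_over ar F t \<Longrightarrow> F \<subseteq> G \<Longrightarrow> term_over ar G t"
  by (induction t) auto

lemma term_over_subst:
  "term_over ar F t \<Longrightarrow> (\<And>x. x \<in> vars t \<Longrightarrow> term_over ar F (\<sigma> x)) \<Longrightarrow>
    term_over ar F (subst \<sigma> t)"
  by (induction t) auto

lemma term_over_substD:
  "term_over ar F (subst \<sigma> t) \<Longrightarrow> x \<in> vars t \<Longrightarrow> term_over ar F (\<sigma> x)"
  by (induction t) auto

lemma subst_cong_vars:
  "(\<And>x. x \<in> vars t \<Longrightarrow> \<sigma> x = \<tau> x) \<Longrightarrow> subst \<sigma> t = subst \<tau> t"
  by (induction t) auto

text \<open>Lets an instance of a rule be read as the rule itself under a changed valuation, the
  form in which the rule inequalities are given.\<close>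

lemma eval_subst: "eval \<theta> \<alpha> (subst \<sigma> t) = eval \<theta> (\<lambda>x. eval \<theta> \<alpha> (\<sigma> x)) t"
  by (induction t) (auto intro!: arg_cong[where f = "\<theta> _"])

lemma map_eval_in_tuples:
  assumes "length ts = n" "\<And>t. t \<in> set ts \<Longrightarrow> eval \<theta> \<alpha> t \<in> K"
  shows "map (eval \<theta> \<alpha>) ts \<in> tuples K n"
  using assms by (auto simp: tuples_def)

text \<open>Monotonicity is assumed only for arguments in \<open>K\<close>; this guarantees that the
  values of terms over the signature qualify.\<close>

lemma eval_in_carrier:
  assumes "assignment K T \<theta>" "valuation K \<alpha>" "term_over (arity T) (symbols T) t"
  shows "eval \<theta> \<alpha> t \<in> K"
  using assms(3)
proof (induction t)
  case (Var x)
  then show ?case using assms(2) by (simp add: valuation_def)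
next
  case (Fun g ts)
  then have "map (eval \<theta> \<alpha>) ts \<in> tuples K (arity T g)"
    by (intro map_eval_in_tuples) auto
  then show ?case using Fun.prems assms(1) by (auto simp: assignment_def)
qed

text \<open>Strict monotonicity speaks of increments taken from \<open>K\<close>, so passing from
  \<open>x\<close> to a larger \<open>y\<close> requires \<open>y - x\<close> to lie in
  \<open>K\<close>.\<close>

lemma strictly_monotonic_imp_monotonic:
  assumes diff: "\<And>x y. x \<in> K \<Longrightarrow> y \<in> K \<Longrightarrow> x \<le> y \<Longrightarrow> y - x \<in> K"
    and smono: "strictly_monotonic K T \<theta>"
  shows "monotonic K T \<theta>"
  unfolding monotonic_def
proof (intro ballI allI impI)
  fix g i xs y
  assume *: "g \<in> symbols T" "i < arity T g" "xs \<in> tuples K (arity T g)" "y \<in> K" "xs ! i \<le> y"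
  show "\<theta> g xs \<le> \<theta> g (xs[i := y])"
  proof (cases "xs ! i = y")
    case True
    then show ?thesis by auto
  next
    \<comment> \<open>The increment must be positive, which is why equality is split off.\<close>
    case False
    have "xs ! i \<in> K" using *(2,3) by (auto simp: tuples_def)
    then have "y - xs ! i \<in> K" "y - xs ! i > 0" using * False diff by auto
    then obtain \<epsilon> where "\<epsilon> > 0" "\<theta> g (xs[i := xs ! i + (y - xs ! i)]) \<ge> \<theta> g xs + \<epsilon>"
      using smono *(1-3) unfolding strictly_monotonic_def by blast
    then show ?thesis by simp
  qed
qed

text \<open>Both claims go through one induction: the reduct of an argument must stay over the
  signature for its value to lie in \<open>K\<close>, where monotonicity applies.\<close>

lemma rstep_term_over_eval_le:
  assumes "constructor_trs T" and asg: "assignment K T \<theta>" and mono: "monotonic K T \<theta>"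
    and decr: "\<And>l r \<beta>. (l, r) \<in> rules T \<Longrightarrow> valuation K \<beta> \<Longrightarrow> eval \<theta> \<beta> l \<ge> eval \<theta> \<beta> r"
    and val: "valuation K \<alpha>"
    and "rstep T s t" "term_over (arity T) (symbols T) s"
  shows "term_over (arity T) (symbols T) t \<and> eval \<theta> \<alpha> t \<le> eval \<theta> \<alpha> s"
  using assms(6,7)
proof induction
  case (root l r \<sigma>)
  have vars: "vars r \<subseteq> vars l" and r: "term_over (arity T) (symbols T) r"
    using root.hyps assms(1) by (auto simp: constructor_trs_def)
  \<comment> \<open>Outside the variables of \<open>l\<close> the substitution may leave the signature, where \<open>eval\<close> need not lie in \<open>K\<close>.\<close>
  define \<tau> where "\<tau> x = (if x \<in> vars l then \<sigma> x else Var x)" for x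
  have \<tau>: "term_over (arity T) (symbols T) (\<tau> x)" for x
    using term_over_substD[OF root.prems] by (simp add: \<tau>_def)
  have "subst \<sigma> l = subst \<tau> l" "subst \<sigma> r = subst \<tau> r"
    using vars by (auto intro!: subst_cong_vars simp: \<tau>_def)
  \<comment> \<open>By \<open>eval_subst\<close>, evaluating both instances under \<alpha> amounts
    to evaluating \<open>l\<close> and \<open>r\<close> under this valuation.\<close>
  moreover have "valuation K (\<lambda>x. eval \<theta> \<alpha> (\<tau> x))"
    using eval_in_carrier[OF asg val \<tau>] by (simp add: valuation_def)
  ultimately show ?case
    using decr[OF root.hyps] term_over_subst[OF r \<tau>] by (simp add: eval_subst)
next
  case (arg s t f ss us)
  let ?e = "eval \<theta> \<alpha>"
  let ?xs = "map ?e (ss @ s # us)"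
  have IH: "term_over (arity T) (symbols T) t" "?e t \<le> ?e s"
    using arg by auto
  have f: "f \<in> symbols T" and len: "length (ss @ s # us) = arity T f"
    using arg.prems by auto
  have xs: "?xs \<in> tuples K (arity T f)"
    using arg.prems len eval_in_carrier[OF asg val] by (intro map_eval_in_tuples) auto
  have ys: "map ?e (ss @ t # us) \<in> tuples K (arity T f)"
    using arg.prems IH len eval_in_carrier[OF asg val] by (intro map_eval_in_tuples) auto
  \<comment> \<open>Monotonicity raises one entry, so start from the arguments after the step and
    restore the larger value of \<open>s\<close> at position \<open>length ss\<close>.\<close>
  have "\<theta> f (map ?e (ss @ t # us)) \<le> \<theta> f ((map ?e (ss @ t # us))[length ss := ?e s])"
    using mono f len ys IH(2) arg.prems eval_in_carrier[OF asg val, of s]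
    unfolding monotonic_def by (auto simp: nth_append)
  also have "(map ?e (ss @ t # us))[length ss := ?e s] = ?xs"
    by (simp add: list_update_append)
  finally show ?case using arg.prems IH by auto
qed

theorem theorem7:
  fixes T :: "('f, 'v) trs" and K :: "real set" and \<theta> :: "'f assignment"
  assumes "K \<in> {\<nat>, nonneg_rats, nonneg_reals}"
    and "constructor_trs T" and "orthogonal T"
    and "interpretation_over K T \<theta>" and "additive_assignment K T \<theta>"
  shows "sup_interpretation K T \<theta>"
proof -
  have asg: "assignment K T \<theta>" and smono: "strictly_monotonic K T \<theta>"
    and decr: "\<And>l r \<beta>. (l, r) \<in> rules T \<Longrightarrow> valuation K \<beta> \<Longrightarrow> eval \<theta> \<beta> l \<ge> eval \<theta> \<beta> r"
    using assms(4) unfolding interpretation_over_def by (auto simp: less_imp_le)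
  \<comment> \<open>For the naturals \<open>x \<le> y\<close> keeps the difference in
    \<open>K\<close>; for the other carriers it supplies nonnegativity.\<close>
  have "y - x \<in> K" if "x \<in> K" "y \<in> K" "x \<le> y" for x y
    using assms(1) that by (auto simp: Nats_diff)
  then have mono: "monotonic K T \<theta>"
    using smono by (rule strictly_monotonic_imp_monotonic)
  have "eval \<theta> \<alpha> (Fun f vs) \<ge> eval \<theta> \<alpha> v"
    if f: "f \<in> defined T" "length vs = arity T f" "\<forall>v\<in>set vs. is_value T v"
      and v: "computes T f vs v" and val: "valuation K \<alpha>" for f vs v \<alpha>
  proof -
    have over: "term_over (arity T) (symbols T) (Fun f vs)"
      using f by (auto simp: symbols_def is_value_def intro: term_over_mono)
    have "(rstep T)\<^sup>*\<^sup>* (Fun f vs) v" using v by (simp add: computes_def)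
    then have "term_over (arity T) (symbols T) v \<and> eval \<theta> \<alpha> v \<le> eval \<theta> \<alpha> (Fun f vs)"
    \<comment> \<open>The signature claim is carried along because each further step presupposes
      it.\<close>
    proof induction
      case base
      then show ?case using over by simp
    next
      case (step t u)
      then show ?case
        using rstep_term_over_eval_le[OF assms(2) asg mono decr val] by (meson order_trans)
    qed
    then show ?thesis by simp
  qed
  then show ?thesis
    using asg mono assms(5) unfolding sup_interpretation_def by blast
qed

end
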